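(* The parameter $\mathrm{STD}_{min}$ is sub-additive but not additive.
   Context: Let $X$ be a finite set. A concept class $C$ over the domain $X=\mathrm{dom}(C)$ is a nonempty family of functions $c:X\to\{0,1\}$ (called concepts). A labeled sample of size $m\ge 0$ is a set $S=\{(x_1,b_1),\ldots,(x_m,b_m)\}\subseteq X\times\{0,1\}$ with $x_1,\ldots,x_m$ distinct; $|S|=m$ (the empty sample is allowed). A concept $c$ is consistent with $S$ if $c(x_i)=b_i$ for all $i$. A $C$-saturating matching is a map $M$ assigning to each $c\in C$ a labeled sample $M(c)$ with which $c$ is consistent, such that $M(c)\ne M(c')$ whenever $c\neq c'$ in $C$. Its cost is $\max_{c\in C}|M(c)|$. A sequence $\mathcal{M}=(M_k)_{k\ge 0}$ of $C$-saturating matchings is a subset teaching sequence for $C$ if $M_0(c)=\{(x,c(x)):x\in X\}$ for all $c\in C$; $M_{k+1}(c)\subseteq M_k(c)$ for all $k\ge0$, $c\in C$; and $M_{k+1}(c)\not\subseteq M_k(c')$ for all $k\ge 0$ and all distinct $c,c'\in C$. Let $k^*(\mathcal{M})=\min\{k:\forall k'\ge k,\ \forall c\in C,\ M_{k'}(c)=M_k(c)\}$ and let $\mathrm{cost}(\mathcal{M})$ be the cost of $M_{k^*(\mathcal{M})}$. Then $\mathrm{STD}_{min}(C)$ is the minimum of $\mathrm{cost}(\mathcal{M})$ over all subset teaching sequences $\mathcal{M}$ for $C$. If $C_1,C_2$ are concept classes over disjoint domains $X_1,X_2$, their free combination is the concept class $C_1\sqcup C_2=\{c_1\cup c_2:c_1\in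 C_1,\ c_2\in C_2\}$ over $X_1\cup X_2$, where $c_1\cup c_2$ is the function that agrees with $c_i$ on $X_i$. A parameter $Y$ is sub-additive if $Y(C_1\sqcup C_2)\le Y(C_1)+Y(C_2)$ for each free combination of two concept classes, and additive if equality holds for each free combination of two concept classes. *)

theory Defs
  imports Main
begin

text \<open>
  A concept over the domain \<open>X\<close> is a partial map with domain exactly \<open>X\<close>, so that distinct
  concepts differ at a point of \<open>X\<close> and the union of two concepts over disjoint domains
  is \<^term>\<open>c1 ++ c2\<close>. The labels 1 and 0 are \<^term>\<open>True\<close> and \<^term>\<open>False\<close>.
\<close>

type_synonym 'a concept = "'a \<rightharpoonup> bool"
type_synonym 'a sample = "('a \<times> bool) set"
type_synonym 'a matching = "'a concept \<Rightarrow> 'a sample"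

definition concept_class :: "'a set \<Rightarrow> 'a concept set \<Rightarrow> bool" where
  "concept_class X C \<longleftrightarrow> finite X \<and> C \<noteq> {} \<and> (\<forall>c\<in>C. dom c = X)"

definition labeled_sample :: "'a set \<Rightarrow> 'a sample \<Rightarrow> bool" where
  "labeled_sample X S \<longleftrightarrow> finite S \<and> S \<subseteq> X \<times> UNIV \<and> single_valued S"

definition consistent :: "'a concept \<Rightarrow> 'a sample \<Rightarrow> bool" where
  "consistent c S \<longleftrightarrow> (\<forall>(x, b)\<in>S. c x = Some b)"

text \<open>Matchings and sequences of matchings are only relevant through their values on \<open>C\<close>.\<close>

definition saturating_matching :: "'a set \<Rightarrow> 'a concept set \<Rightarrow> 'a matching \<Rightarrow> bool" where
  "saturating_matching X C M \<longleftrightarrow>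
     (\<forall>c\<in>C. labeled_sample X (M c) \<and> consistent c (M c)) \<and> inj_on M C"

definition matching_cost :: "'a concept set \<Rightarrow> 'a matching \<Rightarrow> nat" where
  "matching_cost C M = Max ((\<lambda>c. card (M c)) ` C)"

definition subset_teaching_sequence ::
    "'a set \<Rightarrow> 'a concept set \<Rightarrow> (nat \<Rightarrow> 'a matching) \<Rightarrow> bool" where
  "subset_teaching_sequence X C M \<longleftrightarrow>
     (\<forall>k. saturating_matching X C (M k)) \<and>
     (\<forall>c\<in>C. M 0 c = {(x, the (c x)) | x. x \<in> X}) \<and>
     (\<forall>k. \<forall>c\<in>C. M (Suc k) c \<subseteq> M k c) \<and>
     (\<forall>k. \<forall>c\<in>C. \<forall>c'\<in>C. c \<noteq> c' \<longrightarrow> \<not> M (Suc k) c \<subseteq> M k c')"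

definition k_star :: "'a concept set \<Rightarrow> (nat \<Rightarrow> 'a matching) \<Rightarrow> nat" where
  "k_star C M = (LEAST k. \<forall>k'\<ge>k. \<forall>c\<in>C. M k' c = M k c)"

definition sequence_cost :: "'a concept set \<Rightarrow> (nat \<Rightarrow> 'a matching) \<Rightarrow> nat" where
  "sequence_cost C M = matching_cost C (M (k_star C M))"

definition STD_min :: "'a set \<Rightarrow> 'a concept set \<Rightarrow> nat" where
  "STD_min X C = (LEAST d. \<exists>M. subset_teaching_sequence X C M \<and> d = sequence_cost C M)"

text \<open>
  The two lemmas below show that both uses of \<open>LEAST\<close> are genuine minima over nonempty sets.
\<close>

lemma subset_teaching_sequence_exists:
  assumes "concept_class X C"
  shows "\<exists>M. subset_teaching_sequence X C M"
proof -
  define M0 where "M0 c = {(x, the (c x)) | x. x \<in> X}" for c :: "'a concept"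
  have fX: "finite X" and dom: "\<And>c. c \<in> C \<Longrightarrow> dom c = X"
    using assms by (auto simp: concept_class_def)
  have sub: "c = c'" if "c \<in> C" "c' \<in> C" "M0 c \<subseteq> M0 c'" for c c'
  proof
    fix x
    show "c x = c' x"
    proof (cases "x \<in> X")
      case True
      then have "the (c x) = the (c' x)" using that(3) by (auto simp: M0_def)
      moreover have "x \<in> dom c" "x \<in> dom c'" using True dom that by auto
      ultimately show ?thesis by auto
    next
      case False
      then show ?thesis using dom[OF that(1)] dom[OF that(2)] by (metis domIff)
    qed
  qed
  have lab: "labeled_sample X (M0 c)" for c
    using fX by (auto simp: labeled_sample_def M0_def single_valued_def)
  have con: "consistent c (M0 c)" if "c \<in> C" for c
    using dom[OF that] by (auto simp: consistent_def M0_def)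
  have "subset_teaching_sequence X C (\<lambda>_. M0)"
    unfolding subset_teaching_sequence_def saturating_matching_def
    using lab con sub by (auto simp: inj_on_def) (simp_all add: M0_def)
  then show ?thesis by blast
qed

lemma subset_teaching_sequence_stabilizes:
  assumes "concept_class X C" and M: "subset_teaching_sequence X C M"
  shows "\<exists>k. \<forall>k'\<ge>k. \<forall>c\<in>C. M k' c = M k c"
proof -
  have "C \<subseteq> {c. dom c = X \<and> ran c \<subseteq> UNIV}" "finite X"
    using assms(1) by (auto simp: concept_class_def)
  then have finC: "finite C"
    using finite_set_of_finite_maps[of X "UNIV :: bool set"] finite_subset by fastforce
  have anti: "M j c \<subseteq> M i c" if "i \<le> j" "c \<in> C" for i j c
    using that(1)
  proof (rule lift_Suc_antimono_le[of "\<lambda>k. M k c", rotated])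
    show "M (Suc n) c \<subseteq> M n c" for n
      using M that(2) by (simp add: subset_teaching_sequence_def)
  qed
  have fin: "finite (M k c)" if "c \<in> C" for k c
    using M that
    by (auto simp: subset_teaching_sequence_def saturating_matching_def labeled_sample_def)
  define f where "f k = (\<Sum>c\<in>C. card (M k c))" for k
  obtain k where k: "\<And>j. f k \<le> f j"
    using ex_has_least_nat[of "\<lambda>_. True" 0 f] by auto
  have "M j c = M k c" if "j \<ge> k" "c \<in> C" for j c
  proof (rule ccontr)
    assume "M j c \<noteq> M k c"
    then have "card (M j c) < card (M k c)"
      using anti[OF that] fin[OF that(2)] by (simp add: psubset_card_mono psubsetI)
    moreover have "card (M j d) \<le> card (M k d)" if "d \<in> C" for d
      using anti[OF \<open>j \<ge> k\<close> that] fin[OF that] by (simp add: card_mono)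
    ultimately have "f j < f k"
      unfolding f_def using finC \<open>c \<in> C\<close> by (meson sum_strict_mono_ex1)
    then show False using k[of j] by simp
  qed
  then show ?thesis by blast
qed

definition free_combination :: "'a concept set \<Rightarrow> 'a concept set \<Rightarrow> 'a concept set" where
  "free_combination C1 C2 = {c1 ++ c2 | c1 c2. c1 \<in> C1 \<and> c2 \<in> C2}"

definition sub_additive :: "('a set \<Rightarrow> 'a concept set \<Rightarrow> nat) \<Rightarrow> bool" where
  "sub_additive Y \<longleftrightarrow>
     (\<forall>X1 C1 X2 C2. concept_class X1 C1 \<and> concept_class X2 C2 \<and> X1 \<inter> X2 = {} \<longrightarrow>
        Y (X1 \<union> X2) (free_combination C1 C2) \<le> Y X1 C1 + Y X2 C2)"

definition additive :: "('a set \<Rightarrow> 'a concept set \<Rightarrow> nat) \<Rightarrow> bool" where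
  "additive Y \<longleftrightarrow>
     (\<forall>X1 C1 X2 C2. concept_class X1 C1 \<and> concept_class X2 C2 \<and> X1 \<inter> X2 = {} \<longrightarrow>
        Y (X1 \<union> X2) (free_combination C1 C2) = Y X1 C1 + Y X2 C2)"

end

(* For sub-additivity, run optimal sequences for the two classes in parallel, taking unions.
   Additivity fails for the classes of constant functions on two disjoint two-point blocks. The four concepts
   of the free combination are first taught by one point from each block, with the points
   chosen so that afterwards a single labeled example is specific to each concept. Thus the
   free combination has cost at most 1, while every class with two concepts has cost at
   least 1. *)
theory Submission
  imports Defs
begin

section \<open>Basic properties of subset teaching sequences\<close>

lemma subset_teaching_sequence_antimono:
  assumes "subset_teaching_sequence X C M" "c \<in> C" "i \<le> j"
  shows "M j c \<subseteq> M i c"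
proof (rule lift_Suc_antimono_le[of "\<lambda>k. M k c"])
  show "M (Suc k) c \<subseteq> M k c" for k
    using assms by (simp add: subset_teaching_sequence_def)
qed (rule assms)

lemma subset_teaching_sequence_unique:
  assumes "subset_teaching_sequence X C M" "c \<in> C" "c' \<in> C" "M (Suc k) c \<subseteq> M k c'"
  shows "c = c'"
  using assms unfolding subset_teaching_sequence_def by metis

lemma finite_concept_class:
  assumes "concept_class X C"
  shows "finite C"
proof (rule finite_subset)
  show "C \<subseteq> {c. dom c = X \<and> ran c \<subseteq> UNIV}"
    using assms by (auto simp: concept_class_def)
  show "finite {c :: 'a concept. dom c = X \<and> ran c \<subseteq> UNIV}"
    by (rule finite_set_of_finite_maps) (use assms in \<open>auto simp: concept_class_def\<close>)
qed

text \<open>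
  Since \<open>M (Suc k) c \<subseteq> M k c\<close>, the non-inclusion condition already forces every \<open>M k\<close> to be
  injective.
\<close>

lemma subset_teaching_sequenceI:
  assumes C: "concept_class X C"
    and zero: "\<And>c. c \<in> C \<Longrightarrow> M 0 c = {(x, the (c x)) | x. x \<in> X}"
    and dec: "\<And>k c. c \<in> C \<Longrightarrow> M (Suc k) c \<subseteq> M k c"
    and nsub: "\<And>k c c'. c \<in> C \<Longrightarrow> c' \<in> C \<Longrightarrow> M (Suc k) c \<subseteq> M k c' \<Longrightarrow> c = c'"
  shows "subset_teaching_sequence X C M"
proof -
  have "saturating_matching X C (M k)" for k
    unfolding saturating_matching_def
  proof (intro conjI ballI)
    fix c assume c: "c \<in> C"
    \<comment> \<open>Finiteness, single-valuedness and consistency are all inherited from the full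
      sample at stage 0.\<close>
    have sub: "M k c \<subseteq> {(x, the (c x)) | x. x \<in> X}"
      using lift_Suc_antimono_le[of "\<lambda>k. M k c" 0 k] dec[OF c] zero[OF c] by simp
    have X: "finite X" "dom c = X" using C c by (auto simp: concept_class_def)
    have "finite (M k c)"
      using X(1) by (intro finite_subset[OF sub]) simp
    then show "labeled_sample X (M k c)"
      using sub by (auto simp: labeled_sample_def single_valued_def)
    show "consistent c (M k c)"
      unfolding consistent_def
    proof clarify
      fix x b assume "(x, b) \<in> M k c"
      then have "x \<in> dom c" "b = the (c x)" using sub X(2) by auto
      then show "c x = Some b" by auto
    qed
  next
    show "inj_on (M k) C"
      using dec nsub by (metis inj_onI)
  qed
  then show ?thesis
    using zero dec nsub unfolding subset_teaching_sequence_def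
    by (intro conjI allI ballI impI notI) auto
qed

section \<open>Bounding the minimal cost from above and below\<close>

lemma k_star_stable:
  assumes "concept_class X C" "subset_teaching_sequence X C M" "k_star C M \<le> k" "c \<in> C"
  shows "M k c = M (k_star C M) c"
proof -
  have "\<forall>k'\<ge>k_star C M. \<forall>c\<in>C. M k' c = M (k_star C M) c"
    unfolding k_star_def
    by (rule LeastI_ex) (rule subset_teaching_sequence_stabilizes[OF assms(1,2)])
  from this[rule_format, OF assms(3,4)] show ?thesis .
qed

text \<open>Samples only shrink, so the cost at an arbitrary stage \<open>k\<close> bounds the final
  cost; \<open>k_star\<close> never has to be computed for a concrete sequence.\<close>

lemma STD_min_le:
  assumes C: "concept_class X C" and M: "subset_teaching_sequence X C M"
    and card: "\<And>c. c \<in> C \<Longrightarrow> card (M k c) \<le> d"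
  shows "STD_min X C \<le> d"
proof -
  have "card (M (k_star C M) c) \<le> d" if c: "c \<in> C" for c
  proof -
    \<comment> \<open>The order of \<open>k\<close> and \<open>k_star C M\<close> is unknown, so
      both are compared with their maximum.\<close>
    have "M (k_star C M) c \<subseteq> M k c"
      using k_star_stable[OF C M, of "max k (k_star C M)" c] c
        subset_teaching_sequence_antimono[OF M c, of k "max k (k_star C M)"] by simp
    moreover have "finite (M k c)"
      using M c by (auto simp: subset_teaching_sequence_def saturating_matching_def
          labeled_sample_def)
    ultimately show ?thesis
      using card[OF c] card_mono le_trans by blast
  qed
  then have "sequence_cost C M \<le> d"
    using C finite_concept_class[OF C]
    by (simp add: sequence_cost_def matching_cost_def concept_class_def)
  moreover have "STD_min X C \<le> sequence_cost C M"
    unfolding STD_min_def using M by (auto intro: Least_le)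
  ultimately show ?thesis by simp
qed

text \<open>The bound is stated for all late stages, not just for \<open>k_star\<close>, so that
  optimal sequences of two classes can be evaluated at a common stage.\<close>

lemma STD_min_attained:
  assumes C: "concept_class X C"
  shows "\<exists>M k. subset_teaching_sequence X C M \<and> (\<forall>j\<ge>k. \<forall>c\<in>C. card (M j c) \<le> STD_min X C)"
proof -
  have "\<exists>M. subset_teaching_sequence X C M \<and> STD_min X C = sequence_cost C M"
    unfolding STD_min_def
    by (rule LeastI_ex) (use subset_teaching_sequence_exists[OF C] in blast)
  then obtain M where M: "subset_teaching_sequence X C M"
    and cost: "STD_min X C = sequence_cost C M" by blast
  have "card (M j c) \<le> STD_min X C" if "k_star C M \<le> j" "c \<in> C" for j c
    unfolding cost sequence_cost_def matching_cost_def
    using k_star_stable[OF C M that] finite_concept_class[OF C] that by simp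
  with M show ?thesis by blast
qed

text \<open>By injectivity of a matching, at most one concept can receive the empty sample.\<close>

lemma STD_min_pos:
  assumes C: "concept_class X C" and c: "c \<in> C" "c' \<in> C" "c \<noteq> c'"
  shows "0 < STD_min X C"
proof -
  obtain M k where M: "subset_teaching_sequence X C M"
    and cost: "\<And>j c. k \<le> j \<Longrightarrow> c \<in> C \<Longrightarrow> card (M j c) \<le> STD_min X C"
    using STD_min_attained[OF C] by metis
  have sat: "saturating_matching X C (M k)"
    using M by (simp add: subset_teaching_sequence_def)
  then have "M k c \<noteq> M k c'"
    using c by (auto simp: saturating_matching_def inj_on_def)
  moreover have "finite (M k c)" "finite (M k c')"
    using sat c by (auto simp: saturating_matching_def labeled_sample_def)
  ultimately have "0 < card (M k c) \<or> 0 < card (M k c')"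
    by auto
  then show ?thesis
    using cost[OF order_refl c(1)] cost[OF order_refl c(2)] by linarith
qed

section \<open>Free combinations and sub-additivity\<close>

lemma concept_class_free_combination:
  assumes "concept_class X1 C1" "concept_class X2 C2"
  shows "concept_class (X1 \<union> X2) (free_combination C1 C2)"
  unfolding concept_class_def
proof (intro conjI ballI)
  show "finite (X1 \<union> X2)" "free_combination C1 C2 \<noteq> {}"
    using assms by (auto simp: concept_class_def free_combination_def)
  fix c assume "c \<in> free_combination C1 C2"
  then obtain c1 c2 where "c = c1 ++ c2" "c1 \<in> C1" "c2 \<in> C2"
    unfolding free_combination_def by blast
  then show "dom c = X1 \<union> X2"
    using assms unfolding concept_class_def by (simp add: Un_commute)
qed

text \<open>Recovers the two components of a concept in a free combination. Since \<open>g\<close>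
  takes precedence in \<open>f ++ g\<close>, disjointness is what keeps \<open>f\<close> from being
  overwritten.\<close>

lemma restrict_map_add_disjoint:
  assumes "dom f \<inter> dom g = {}"
  shows "(f ++ g) |` dom f = f" and "(f ++ g) |` dom g = g"
proof -
  show "(f ++ g) |` dom f = f"
  proof
    fix x show "((f ++ g) |` dom f) x = f x"
      using assms by (cases "x \<in> dom f")
        (auto simp: disjoint_iff domIff restrict_map_def map_add_def split: option.splits)
  qed
  show "(f ++ g) |` dom g = g"
    by (auto simp: fun_eq_iff restrict_map_def domIff map_add_def split: option.splits)
qed

lemma sub_additive_STD_min: "sub_additive STD_min"
  unfolding sub_additive_def
proof (intro allI impI, elim conjE)
  fix X1 X2 :: "'a set" and C1 C2
  assume C1: "concept_class X1 C1" and C2: "concept_class X2 C2" and disj: "X1 \<inter> X2 = {}"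
  let ?C = "free_combination C1 C2"
  obtain M1 k1 where M1: "subset_teaching_sequence X1 C1 M1"
    and cost1: "\<And>j c. k1 \<le> j \<Longrightarrow> c \<in> C1 \<Longrightarrow> card (M1 j c) \<le> STD_min X1 C1"
    using STD_min_attained[OF C1] by metis
  obtain M2 k2 where M2: "subset_teaching_sequence X2 C2 M2"
    and cost2: "\<And>j c. k2 \<le> j \<Longrightarrow> c \<in> C2 \<Longrightarrow> card (M2 j c) \<le> STD_min X2 C2"
    using STD_min_attained[OF C2] by metis
  \<comment> \<open>A matching takes the combined concept as its argument, so the components are
    extracted by restriction.\<close>
  define N where "N k c = M1 k (c |` X1) \<union> M2 k (c |` X2)" for k c
  have dom: "dom c1 = X1" "dom c2 = X2" if "c1 \<in> C1" "c2 \<in> C2" for c1 c2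
    using C1 C2 that by (auto simp: concept_class_def)
  have restrict: "(c1 ++ c2) |` X1 = c1" "(c1 ++ c2) |` X2 = c2"
    if "c1 \<in> C1" "c2 \<in> C2" for c1 c2
    using restrict_map_add_disjoint[of c1 c2] dom[OF that] disj by simp_all
  have N: "N k (c1 ++ c2) = M1 k c1 \<union> M2 k c2" if "c1 \<in> C1" "c2 \<in> C2" for k c1 c2
    using restrict[OF that] by (simp add: N_def)
  have C: "concept_class (X1 \<union> X2) ?C"
    by (rule concept_class_free_combination[OF C1 C2])
  have on1: "M1 k c \<subseteq> X1 \<times> UNIV" if "c \<in> C1" for k c
    using M1 that by (auto simp: subset_teaching_sequence_def saturating_matching_def
        labeled_sample_def)
  have on2: "M2 k c \<subseteq> X2 \<times> UNIV" if "c \<in> C2" for k c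
    using M2 that by (auto simp: subset_teaching_sequence_def saturating_matching_def
        labeled_sample_def)
  have "subset_teaching_sequence (X1 \<union> X2) ?C N"
  proof (rule subset_teaching_sequenceI[OF C])
    fix c assume "c \<in> ?C"
    then obtain c1 c2 where c: "c = c1 ++ c2" "c1 \<in> C1" "c2 \<in> C2"
      by (auto simp: free_combination_def)
    have "c x = c1 x" if "x \<in> X1" for x
      using restrict(1)[OF c(2,3)] that c(1) by (metis restrict_in)
    moreover have "c x = c2 x" if "x \<in> X2" for x
      using restrict(2)[OF c(2,3)] that c(1) by (metis restrict_in)
    moreover have "N 0 c = {(x, the (c1 x)) | x. x \<in> X1} \<union> {(x, the (c2 x)) | x. x \<in> X2}"
      using c N[of c1 c2 0] M1 M2 by (simp add: subset_teaching_sequence_def)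
    ultimately show "N 0 c = {(x, the (c x)) | x. x \<in> X1 \<union> X2}"
      by (simp only: Setcompr_eq_image image_Un cong: image_cong)
    show "N (Suc k) c \<subseteq> N k c" for k
      unfolding c(1) N[OF c(2,3)] using c M1 M2
      by (intro Un_mono subset_teaching_sequence_antimono) auto
  next
    fix k c c' assume c: "c \<in> ?C" and c': "c' \<in> ?C" and sub: "N (Suc k) c \<subseteq> N k c'"
    obtain c1 c2 where c: "c = c1 ++ c2" "c1 \<in> C1" "c2 \<in> C2"
      using c by (auto simp: free_combination_def)
    obtain c1' c2' where c': "c' = c1' ++ c2'" "c1' \<in> C1" "c2' \<in> C2"
      using c' by (auto simp: free_combination_def)
    have "M1 (Suc k) c1 \<union> M2 (Suc k) c2 \<subseteq> M1 k c1' \<union> M2 k c2'"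
      using sub N c c' by simp
    \<comment> \<open>The samples of \<open>M1\<close> and \<open>M2\<close> lie over disjoint
      domains, so the inclusion of unions splits into two inclusions.\<close>
    then have "M1 (Suc k) c1 \<subseteq> M1 k c1'" "M2 (Suc k) c2 \<subseteq> M2 k c2'"
      using on1[OF c(2), of "Suc k"] on2[OF c(3), of "Suc k"] on1[OF c'(2), of k]
        on2[OF c'(3), of k] disj by blast+
    then have "c1 = c1'" "c2 = c2'"
      using subset_teaching_sequence_unique M1 M2 c c' by blast+
    then show "c = c'" by (simp add: c c')
  qed
  then show "STD_min (X1 \<union> X2) ?C \<le> STD_min X1 C1 + STD_min X2 C2"
  proof (rule STD_min_le[OF C])
    fix c assume "c \<in> ?C"
    then obtain c1 c2 where c: "c = c1 ++ c2" "c1 \<in> C1" "c2 \<in> C2"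
      by (auto simp: free_combination_def)
    \<comment> \<open>Both sequences have reached their optimal cost by stage
      \<open>max k1 k2\<close>.\<close>
    have "card (N (max k1 k2) c) \<le> card (M1 (max k1 k2) c1) + card (M2 (max k1 k2) c2)"
      using c N by (simp add: card_Un_le)
    also have "\<dots> \<le> STD_min X1 C1 + STD_min X2 C2"
      using c by (intro add_mono cost1 cost2) auto
    finally show "card (N (max k1 k2) c) \<le> STD_min X1 C1 + STD_min X2 C2" .
  qed
qed

section \<open>A counterexample to additivity\<close>

text \<open>For distinct \<open>i\<close> and \<open>j\<close>, either point alone reveals the
  common label, so the choice between them is free to carry further information.\<close>

definition const_pair :: "nat \<Rightarrow> nat \<Rightarrow> nat concept set" where
  "const_pair i j = range (\<lambda>b. [i \<mapsto> b, j \<mapsto> b])"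

lemma concept_class_const_pair: "concept_class {i, j} (const_pair i j)"
  by (auto simp: concept_class_def const_pair_def)

lemma STD_min_const_pair_pos: "0 < STD_min {i, j} (const_pair i j)"
proof (rule STD_min_pos[OF concept_class_const_pair])
  show "[i \<mapsto> True, j \<mapsto> True] \<noteq> [i \<mapsto> False, j \<mapsto> False]"
    by (auto dest: fun_cong[of _ _ j])
qed (auto simp: const_pair_def)

text \<open>Writing TF for label \<open>True\<close> on block 0, 1 and \<open>False\<close> on block
  2, 3, stage 1 uses points 0, 3 for TT; 0, 2 for FF; 1, 3 for TF; 1, 2 for FT. The examples kept
  from stage 2 on are \<open>(0, True)\<close>, \<open>(0, False)\<close>,
  \<open>(3, False)\<close>, \<open>(2, True)\<close> respectively, and each occurs in exactly one
  of the four stage 1 samples.\<close>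

fun two_block_points :: "nat \<Rightarrow> nat concept \<Rightarrow> nat set" where
  "two_block_points 0 c = {0, 1, 2, 3}"
| "two_block_points (Suc 0) c =
     {if c 0 = c 2 then 0 else 1, if c 0 = Some True then 3 else 2}"
| "two_block_points (Suc (Suc k)) c =
     (if c 0 = c 2 then {0} else {if c 0 = Some True then 3 else 2})"

lemma STD_min_two_blocks_le:
  "STD_min ({0, 1} \<union> {2, 3}) (free_combination (const_pair 0 1) (const_pair 2 3)) \<le> 1"
  (is "STD_min ?X ?C \<le> 1")
proof -
  define M :: "nat \<Rightarrow> nat matching"
    where "M k c = (\<lambda>x. (x, the (c x))) ` two_block_points k c" for k c
  have elems: "\<exists>p q. c = [0 \<mapsto> p, 1 \<mapsto> p] ++ [2 \<mapsto> q, 3 \<mapsto> q]" if "c \<in> ?C" for c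
    using that unfolding free_combination_def const_pair_def by blast
  have C: "concept_class ?X ?C"
    by (intro concept_class_free_combination concept_class_const_pair)
  have "subset_teaching_sequence ?X ?C M"
  proof (rule subset_teaching_sequenceI[OF C])
    fix c assume c: "c \<in> ?C"
    show "M 0 c = {(x, the (c x)) | x. x \<in> ?X}"
      by (auto simp: M_def)
    show "M (Suc k) c \<subseteq> M k c" for k
      unfolding M_def by (rule image_mono, cases "(k, c)" rule: two_block_points.cases) auto
  next
    fix k c c' assume "c \<in> ?C" "c' \<in> ?C" and sub: "M (Suc k) c \<subseteq> M k c'"
    obtain p q where p: "c = [0 \<mapsto> p, 1 \<mapsto> p] ++ [2 \<mapsto> q, 3 \<mapsto> q]"
      using elems[OF \<open>c \<in> ?C\<close>] by blast
    obtain p' q' where p': "c' = [0 \<mapsto> p', 1 \<mapsto> p'] ++ [2 \<mapsto> q', 3 \<mapsto> q']"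
      using elems[OF \<open>c' \<in> ?C\<close>] by blast
    have "p = p' \<and> q = q'"
      using sub unfolding M_def p p'
      \<comment> \<open>For \<open>k = 0\<close> the stage 1 sample has a point in each block and so
        fixes both labels. For \<open>k = 1\<close> the single example is sought in the stage 1
        sample of \<open>c'\<close>, and for larger \<open>k\<close> distinct singletons are
        compared.\<close>
      by (cases "(k, c)" rule: two_block_points.cases; cases p; cases q; cases p'; cases q')
        (auto simp: map_add_def)
    then show "c = c'" by (simp add: p p')
  qed
  then show ?thesis
    \<comment> \<open>Stage 2 is the first at which every sample is a singleton.\<close>
    by (rule STD_min_le[OF C, where k = 2]) (simp add: M_def numeral_2_eq_2)
qed

theorem mainTheorem6:
  "sub_additive (STD_min :: 'a set \<Rightarrow> 'a concept set \<Rightarrow> nat) \<and>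
   \<not> additive (STD_min :: nat set \<Rightarrow> nat concept set \<Rightarrow> nat)"
proof
  show "sub_additive (STD_min :: 'a set \<Rightarrow> 'a concept set \<Rightarrow> nat)"
    by (rule sub_additive_STD_min)
  \<comment> \<open>The type is fixed to \<open>nat\<close> because the counterexample uses four
    distinct points, which an arbitrary type need not provide.\<close>
  show "\<not> additive (STD_min :: nat set \<Rightarrow> nat concept set \<Rightarrow> nat)"
  proof
    assume "additive (STD_min :: nat set \<Rightarrow> nat concept set \<Rightarrow> nat)"
    then have eq: "STD_min (X1 \<union> X2) (free_combination C1 C2) = STD_min X1 C1 + STD_min X2 C2"
      if "concept_class X1 C1" "concept_class X2 C2" "X1 \<inter> X2 = {}"
      for X1 X2 :: "nat set" and C1 C2
      using that unfolding additive_def by blast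
    have "STD_min ({0, 1} \<union> {2, 3}) (free_combination (const_pair 0 1) (const_pair 2 3)) =
        STD_min {0, 1} (const_pair 0 1) + STD_min {2, 3} (const_pair 2 3)"
      by (intro eq concept_class_const_pair) simp
    then show False
      using STD_min_two_blocks_le STD_min_const_pair_pos[of 0 1] STD_min_const_pair_pos[of 2 3]
      by linarith
  qed
qed

end
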